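(* Let $G$ be a finitely generated infinite group. Assume that $S$ is a finite symmetric generating set of $G$ such that for any $x\in G$ the Busemann boundary $\partial_b\Gamma(G,U)$ is finite, where $U=S\cup\{x,x^{-1}\}$. Then $G$ is virtually $\mathbb{Z}$.
   Context: Virtually $\mathbb{Z}$ means containing a finite index infinite cyclic subgroup. Let $S$ be any finite symmetric ($S=S^{-1}$) generating set of $G$. The Cayley graph $\Gamma(G,S)$ has vertex set $G$ and edges $\{x,xs\}$ for $x\in G$, $s\in S$; $d_S$ denotes its graph metric (which is left-invariant), and $1$ is the identity of $G$. Let $L(G,S)$ be the set of functions $h:G\to\mathbb{R}$ with $|h(x)-h(y)|\le d_S(x,y)$ for all $x,y\in G$ and $h(1)=0$, with the topology of pointwise convergence. For $x\in G$ let $b_x\in L(G,S)$ be $b_x(y)=d_S(x,y)-d_S(x,1)$. Let $\overline{\Gamma(G,S)}$ be the closure of $\{b_x : x\in G\}$ in $L(G,S)$, and let $\partial\Gamma(G,S)=\overline{\Gamma(G,S)}\setminus\{b_x : x\in G\}$ be the horofunction boundary. A geodesic in $\Gamma(G,S)$ is an infinite sequence $(\gamma_k)_{k\ge 0}$ in $G$ with $d_S(\gamma_k,\gamma_m)=k-m$ for all $0\le m\le k$. For every geodesic $\gamma$ the pointwise limit $\gamma_\infty=\lim_{n\to\infty} b_{\gamma_n}$ exists and lies in $\partial\Gamma(G,S)$. A Busemann point is an element of $\partial\Gamma(G,S)$ of the form $\gamma_\infty$ for some geodesic $\gamma$. The Busemann boundary $\partial_b\Gamma(G,S)$ is the closure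 in $\overline{\Gamma(G,S)}$ of the set of all Busemann points. The same definitions apply with $U$ in place of $S$. *)

theory Defs
  imports "HOL-Analysis.Analysis" "HOL-Algebra.Elementary_Groups"
begin

definition virtually_Z :: "('a, 'b) monoid_scheme \<Rightarrow> bool" where
  "virtually_Z G \<longleftrightarrow>
     (\<exists>H. subgroup H G \<and> finite (rcosets\<^bsub>G\<^esub> H) \<and>
          infinite H \<and> cyclic_group (G\<lparr>carrier := H\<rparr>))"

definition cayley_edges :: "('a, 'b) monoid_scheme \<Rightarrow> 'a set \<Rightarrow> 'a set set" where
  "cayley_edges G S = {{x, x \<otimes>\<^bsub>G\<^esub> s} | x s. x \<in> carrier G \<and> s \<in> S}"

(* The least length of an edge path from x to y. This is the graph metric when S generates G;
   if x and y are not connected, no n qualifies and the value carries no information. *)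
definition cayley_dist :: "('a, 'b) monoid_scheme \<Rightarrow> 'a set \<Rightarrow> 'a \<Rightarrow> 'a \<Rightarrow> nat" where
  "cayley_dist G S x y = (LEAST n. (x, y) \<in> {(u, v). {u, v} \<in> cayley_edges G S} ^^ n)"

(* Functions from G to the reals are represented by extensional functions on carrier G
   (value undefined outside), the points of the product topology powertop_real (carrier G). *)
definition lip_functions :: "('a, 'b) monoid_scheme \<Rightarrow> 'a set \<Rightarrow> ('a \<Rightarrow> real) set" where
  "lip_functions G S =
     {h \<in> extensional (carrier G).
        (\<forall>x\<in>carrier G. \<forall>y\<in>carrier G. \<bar>h x - h y\<bar> \<le> real (cayley_dist G S x y)) \<and>
        h \<one>\<^bsub>G\<^esub> = 0}"

definition lip_topology :: "('a, 'b) monoid_scheme \<Rightarrow> 'a set \<Rightarrow> ('a \<Rightarrow> real) topology" where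
  "lip_topology G S = subtopology (powertop_real (carrier G)) (lip_functions G S)"

definition horo_embedding :: "('a, 'b) monoid_scheme \<Rightarrow> 'a set \<Rightarrow> 'a \<Rightarrow> 'a \<Rightarrow> real" where
  "horo_embedding G S x =
     (\<lambda>y\<in>carrier G. real (cayley_dist G S x y) - real (cayley_dist G S x \<one>\<^bsub>G\<^esub>))"

definition horo_compactification :: "('a, 'b) monoid_scheme \<Rightarrow> 'a set \<Rightarrow> ('a \<Rightarrow> real) set" where
  "horo_compactification G S = lip_topology G S closure_of (horo_embedding G S ` carrier G)"

definition horo_boundary :: "('a, 'b) monoid_scheme \<Rightarrow> 'a set \<Rightarrow> ('a \<Rightarrow> real) set" where
  "horo_boundary G S = horo_compactification G S - horo_embedding G S ` carrier G"

definition cayley_geodesic :: "('a, 'b) monoid_scheme \<Rightarrow> 'a set \<Rightarrow> (nat \<Rightarrow> 'a) \<Rightarrow> bool" where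
  "cayley_geodesic G S \<gamma> \<longleftrightarrow>
     range \<gamma> \<subseteq> carrier G \<and> (\<forall>m k. m \<le> k \<longrightarrow> cayley_dist G S (\<gamma> k) (\<gamma> m) = k - m)"

definition busemann_points :: "('a, 'b) monoid_scheme \<Rightarrow> 'a set \<Rightarrow> ('a \<Rightarrow> real) set" where
  "busemann_points G S =
     {\<xi> \<in> horo_boundary G S.
        \<exists>\<gamma>. cayley_geodesic G S \<gamma> \<and>
            limitin (lip_topology G S) (\<lambda>n. horo_embedding G S (\<gamma> n)) \<xi> sequentially}"

definition busemann_boundary :: "('a, 'b) monoid_scheme \<Rightarrow> 'a set \<Rightarrow> ('a \<Rightarrow> real) set" where
  "busemann_boundary G S =
     subtopology (lip_topology G S) (horo_compactification G S) closure_of busemann_points G S"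

end

theory Submission
  imports Defs
begin

text \<open>The proof works with the Busemann functions of one Cayley graph, whose generating set
  adjoins only the identity to the given one. This finite set of functions is permuted by the
  group, where \<open>g\<close> sends \<open>h\<close> to the function \<open>y \<mapsto> h (g y) - h g\<close>.

  Two vertices of a
  geodesic ray must act on the finite set in the same way, so their quotient \<open>x\<close>, of length
  \<open>L\<close> say, fixes every Busemann function \<open>h\<close>, that is, \<open>h (x y) = h x + h y\<close>
  (\<open>fixing_element\<close>). One of these functions takes the value \<open>- L\<close> at \<open>x\<close>. It is
  1-Lipschitz and equals \<open>- n L\<close> at \<open>x\<^sup>n\<close>, which makes the powers of \<open>x\<close> a geodesic
  (\<open>powers_geo\<close>), and \<open>f y = lim (d(x\<^sup>n, y) - n L)\<close> exists and satisfies
  \<open>f (x y) = f y - L\<close>. Every coset of the infinite cyclic group generated by \<open>x\<close> therefore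
  meets the strip of all \<open>a\<close> with \<open>0 \<le> f a < L\<close>, and it is enough that this strip
  is finite (\<open>finite_strip\<close>).

  Suppose that it is infinite. For \<open>a\<close> in the strip let \<open>n\<close> be least with
  \<open>d(x\<^sup>n, a) = n L + f a\<close>. Moving a geodesic from \<open>x\<^sup>n\<close> to \<open>a\<close> by \<open>x\<^sup>-\<^sup>n\<close> gives a
  geodesic from the identity to \<open>q = x\<^sup>-\<^sup>n a\<close>, and since \<open>f q = d(1, q)\<close>, the function
  \<open>f\<close> grows at unit speed along it. These geodesics accumulate at a ray \<open>\<beta>\<close> with
  \<open>f (\<beta> m) \<ge> m\<close>. Let \<open>h\<close> be its Busemann function. As \<open>f\<close> is 1-Lipschitz,
  \<open>h \<ge> - f\<close>, so \<open>h x \<ge> L\<close>. But \<open>x\<close> fixes \<open>h\<close>, so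
  \<open>h (x\<^sup>-\<^sup>1) = - h x \<le> - L\<close>: passing through \<open>x\<^sup>-\<^sup>1\<close> is no detour on the way from the
  identity to a far vertex of \<open>\<beta>\<close>, nor then on the way to some \<open>q\<close>. Moved back by
  \<open>x\<^sup>n\<close>, this says \<open>d(x\<^sup>n\<^sup>-\<^sup>1, a) = (n - 1) L + f a\<close>, and \<open>n\<close> was not least.\<close>


section \<open>The word metric\<close>

locale word_metric = group G for G :: "('a, 'b) monoid_scheme" (structure) +
  fixes T :: "'a set"
  assumes T_carrier: "T \<subseteq> carrier G"
    and T_finite: "finite T"
    and T_inv: "s \<in> T \<Longrightarrow> inv s \<in> T"
    and T_generates: "generate G T = carrier G"
begin

abbreviation d :: "'a \<Rightarrow> 'a \<Rightarrow> nat" where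
  "d \<equiv> cayley_dist G T"

text \<open>A directed description of the edges is easier to follow along a path than the two-element
  sets that make up the Cayley graph; the two agree because \<open>T\<close> is symmetric.\<close>

definition adj :: "('a \<times> 'a) set" where
  "adj = {(u, v). {u, v} \<in> cayley_edges G T}"

lemma adj_iff: "(u, v) \<in> adj \<longleftrightarrow> u \<in> carrier G \<and> (\<exists>s\<in>T. v = u \<otimes> s)"
proof
  assume "(u, v) \<in> adj"
  then obtain x s where xs: "{u, v} = {x, x \<otimes> s}" "x \<in> carrier G" "s \<in> T"
    by (auto simp: adj_def cayley_edges_def)
  then consider "u = x" "v = x \<otimes> s" | "v = x" "u = x \<otimes> s"
    by (auto simp: doubleton_eq_iff)
  then show "u \<in> carrier G \<and> (\<exists>s\<in>T. v = u \<otimes> s)"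
  proof cases
    case 1
    then show ?thesis using xs by auto
  next
    case 2
    have "s \<in> carrier G" using xs T_carrier by auto
    then have "v = u \<otimes> inv s" using xs 2 by (simp add: m_assoc)
    then show ?thesis using 2 xs T_inv \<open>s \<in> carrier G\<close> by auto
  qed
next
  assume "u \<in> carrier G \<and> (\<exists>s\<in>T. v = u \<otimes> s)"
  then show "(u, v) \<in> adj" by (auto simp: adj_def cayley_edges_def)
qed

lemma adj_sym: "(u, v) \<in> adj \<Longrightarrow> (v, u) \<in> adj"
  by (simp add: adj_def insert_commute)

lemma path_sym: "(u, v) \<in> adj ^^ n \<Longrightarrow> (v, u) \<in> adj ^^ n"
proof (induction n arbitrary: v)
  case (Suc n)
  then obtain w where "(u, w) \<in> adj ^^ n" "(w, v) \<in> adj" by auto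
  with Suc.IH show ?case by (meson adj_sym relpow_Suc_I2)
qed auto

lemma path_translate:
  assumes "g \<in> carrier G"
  shows "(u, v) \<in> adj ^^ n \<Longrightarrow> u \<in> carrier G \<Longrightarrow> v \<in> carrier G \<and> (g \<otimes> u, g \<otimes> v) \<in> adj ^^ n"
proof (induction n arbitrary: v)
  case (Suc n)
  then obtain w where w: "(u, w) \<in> adj ^^ n" "(w, v) \<in> adj" by auto
  then obtain s where s: "s \<in> T" "v = w \<otimes> s" by (auto simp: adj_iff)
  have "w \<in> carrier G" "(g \<otimes> u, g \<otimes> w) \<in> adj ^^ n" using Suc w by auto
  moreover have sc: "s \<in> carrier G" using s T_carrier by auto
  moreover have "g \<otimes> v = g \<otimes> w \<otimes> s"
    using s sc assms \<open>w \<in> carrier G\<close> by (simp add: m_assoc)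
  then have "(g \<otimes> w, g \<otimes> v) \<in> adj"
    using s assms \<open>w \<in> carrier G\<close> by (auto simp: adj_iff)
  ultimately show ?case using s by auto
qed (use assms in auto)

lemma connected:
  assumes "u \<in> carrier G" "v \<in> carrier G"
  shows "\<exists>n. (u, v) \<in> adj ^^ n"
proof -
  have "\<exists>n. (u, u \<otimes> g) \<in> adj ^^ n" if "g \<in> generate G T" "u \<in> carrier G" for u g
    using that
  proof (induction g arbitrary: u rule: generate.induct)
    case one
    then show ?case by (auto intro!: exI[of _ 0])
  next
    case (incl h)
    then show ?case by (auto intro!: exI[of _ 1] simp: adj_iff)
  next
    case (inv h)
    then have "(u, u \<otimes> inv h) \<in> adj ^^ 1" using T_inv[of h] by (auto simp: adj_iff)
    then show ?case by blast
  next
    case (eng g h)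
    have gh: "g \<in> carrier G" "h \<in> carrier G" using eng T_generates by auto
    obtain m where m: "(u, u \<otimes> g) \<in> adj ^^ m" using eng by blast
    obtain n where "(u \<otimes> g, u \<otimes> g \<otimes> h) \<in> adj ^^ n" using eng gh by (meson m_closed)
    then show ?case using relpow_trans[OF m] gh eng.prems by (auto simp: m_assoc)
  qed
  from this[of "inv u \<otimes> v" u] show ?thesis
    using assms T_generates by (simp add: m_assoc[symmetric])
qed

lemma d_path:
  assumes "u \<in> carrier G" "v \<in> carrier G"
  shows "(u, v) \<in> adj ^^ d u v"
  using connected[OF assms] unfolding cayley_dist_def adj_def by (rule LeastI_ex)

lemma d_le: "(u, v) \<in> adj ^^ n \<Longrightarrow> d u v \<le> n"
  unfolding cayley_dist_def adj_def by (rule Least_le)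

lemma d_self [simp]: "d u u = 0"
  using d_le[of u u 0] by simp

lemma d_eq_0: "u \<in> carrier G \<Longrightarrow> v \<in> carrier G \<Longrightarrow> d u v = 0 \<longleftrightarrow> u = v"
  using d_path[of u v] by auto

lemma d_sym: "u \<in> carrier G \<Longrightarrow> v \<in> carrier G \<Longrightarrow> d u v = d v u"
  by (meson d_le d_path path_sym le_antisym)

lemma d_triangle:
  "u \<in> carrier G \<Longrightarrow> v \<in> carrier G \<Longrightarrow> w \<in> carrier G \<Longrightarrow> d u w \<le> d u v + d v w"
  by (meson d_le d_path relpow_trans)

lemma d_translate:
  assumes "g \<in> carrier G" "u \<in> carrier G" "v \<in> carrier G"
  shows "d (g \<otimes> u) (g \<otimes> v) = d u v"
proof (rule antisym)
  show "d (g \<otimes> u) (g \<otimes> v) \<le> d u v"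
    using path_translate[OF _ d_path] assms by (meson d_le)
  have "(inv g \<otimes> (g \<otimes> u), inv g \<otimes> (g \<otimes> v)) \<in> adj ^^ d (g \<otimes> u) (g \<otimes> v)"
    using path_translate[OF _ d_path] assms by (meson inv_closed m_closed)
  then show "d u v \<le> d (g \<otimes> u) (g \<otimes> v)"
    using assms by (simp add: d_le m_assoc[symmetric])
qed

lemma d_step_le: "u \<in> carrier G \<Longrightarrow> s \<in> T \<Longrightarrow> d u (u \<otimes> s) \<le> 1"
  by (rule d_le) (auto simp: adj_iff)

lemma d_step:
  assumes "u \<in> carrier G" "v \<in> carrier G" "u \<noteq> v"
  shows "\<exists>s\<in>T. d u v = Suc (d (u \<otimes> s) v)"
proof -
  obtain k where k: "d u v = Suc k" using d_eq_0 assms by (meson not0_implies_Suc)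
  then obtain w where "(u, w) \<in> adj" "(w, v) \<in> adj ^^ k"
    using d_path[OF assms(1,2)] by (metis relpow_Suc_D2)
  then obtain s where s: "s \<in> T" "d (u \<otimes> s) v \<le> k" using d_le by (auto simp: adj_iff)
  have "u \<otimes> s \<in> carrier G" using s T_carrier assms by auto
  then have "d u v \<le> 1 + d (u \<otimes> s) v"
    using d_triangle[of u "u \<otimes> s" v] d_step_le[of u s] s assms by linarith
  then show ?thesis using s k by (intro bexI[of _ s]) auto
qed

lemma finite_sphere: "finite {v. (u, v) \<in> adj ^^ n}"
proof (induction n)
  case (Suc n)
  have "{v. (u, v) \<in> adj ^^ Suc n} \<subseteq> (\<Union>w\<in>{w. (u, w) \<in> adj ^^ n}. (\<lambda>s. w \<otimes> s) ` T)"
    by (fastforce simp: adj_iff)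
  then show ?case using Suc T_finite by (meson finite_UN_I finite_imageI finite_subset)
qed auto

lemma finite_ball:
  assumes "u \<in> carrier G"
  shows "finite {v \<in> carrier G. d u v \<le> r}"
proof -
  have "{v \<in> carrier G. d u v \<le> r} \<subseteq> (\<Union>n\<le>r. {v. (u, v) \<in> adj ^^ n})"
    using d_path[OF assms] by fastforce
  then show ?thesis using finite_sphere by (meson finite_UN_I finite_atMost finite_subset)
qed


section \<open>Geodesics\<close>

text \<open>Allowing steps of a fixed length \<open>L\<close> lets the powers of a group element, which need not
  run through consecutive vertices, be treated together with geodesics.\<close>

definition geo :: "nat \<Rightarrow> (nat \<Rightarrow> 'a) \<Rightarrow> bool" where
  "geo L p \<longleftrightarrow> range p \<subseteq> carrier G \<and> (\<forall>m k. m \<le> k \<longrightarrow> d (p k) (p m) = (k - m) * L)"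

lemma geo_1: "geo 1 p \<longleftrightarrow> cayley_geodesic G T p"
  by (simp add: geo_def cayley_geodesic_def)

lemma geo_carrier: "geo L p \<Longrightarrow> p n \<in> carrier G"
  by (auto simp: geo_def)

lemma geo_translate: "g \<in> carrier G \<Longrightarrow> geo L p \<Longrightarrow> geo L (\<lambda>n. g \<otimes> p n)"
  by (auto simp: geo_def d_translate image_subset_iff)

text \<open>Koenig's lemma: geodesic segments from the identity to infinitely many points accumulate,
  because each vertex has only finitely many neighbours. Infinitely many target points stay
  available at every step of the recursion.\<close>

lemma geodesic_towards:
  assumes P: "P \<subseteq> carrier G" "infinite P"
  obtains \<beta> where "geo 1 \<beta>" "\<beta> 0 = \<one>" "\<And>m. \<exists>p\<in>P. d \<one> p = m + d (\<beta> m) p"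
proof -
  define A where "A m u = {p \<in> P. d \<one> p = m + d u p}" for m u
  define Good where "Good m u \<longleftrightarrow> u \<in> carrier G \<and> d \<one> u = m \<and> infinite (A m u)" for m u
  have step: "\<exists>v. Good (Suc m) v \<and> d u v \<le> 1" if "Good m u" for m u
  proof -
    have u: "u \<in> carrier G" "d \<one> u = m" "infinite (A m u)" using that by (auto simp: Good_def)
    have "A m u - {u} \<subseteq> (\<Union>s\<in>T. A (Suc m) (u \<otimes> s))"
    proof
      fix p assume p: "p \<in> A m u - {u}"
      then obtain s where "s \<in> T" "d u p = Suc (d (u \<otimes> s) p)"
        using d_step[of u p] u P by (auto simp: A_def)
      then show "p \<in> (\<Union>s\<in>T. A (Suc m) (u \<otimes> s))" using p by (auto simp: A_def)
    qed
    moreover have "infinite (A m u - {u})" using u by simp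
    ultimately obtain s where s: "s \<in> T" "infinite (A (Suc m) (u \<otimes> s))"
      using T_finite by (meson finite_UN_I finite_subset)
    have us: "u \<otimes> s \<in> carrier G" using s u T_carrier by auto
    obtain p where p: "p \<in> A (Suc m) (u \<otimes> s)" using s by fastforce
    have "p \<in> carrier G" using p P by (auto simp: A_def)
    then have "d \<one> p \<le> d \<one> (u \<otimes> s) + d (u \<otimes> s) p"
      using d_triangle[of \<one> "u \<otimes> s" p] us by simp
    moreover have "d \<one> (u \<otimes> s) \<le> d \<one> u + d u (u \<otimes> s)"
      using d_triangle[of \<one> u "u \<otimes> s"] us u by simp
    moreover have le: "d u (u \<otimes> s) \<le> 1" using d_step_le s u by simp
    ultimately have "d \<one> (u \<otimes> s) = Suc m" using p u by (auto simp: A_def)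
    then show ?thesis using s us le unfolding Good_def by blast
  qed
  have "Good 0 \<one>" using P by (auto simp: Good_def A_def)
  then obtain \<beta>' where \<beta>': "\<And>m. Good m (\<beta>' m)" "\<And>m. d (\<beta>' m) (\<beta>' (Suc m)) \<le> 1"
    using dependent_nat_choice[of Good "\<lambda>_ u v. d u v \<le> 1"] step by blast
  have c: "\<beta>' m \<in> carrier G" "d \<one> (\<beta>' m) = m" for m using \<beta>' by (auto simp: Good_def)
  have upper: "d (\<beta>' m) (\<beta>' (m + j)) \<le> j" for m j
  proof (induction j)
    case (Suc j)
    then show ?case
      using d_triangle[of "\<beta>' m" "\<beta>' (m + j)" "\<beta>' (Suc (m + j))"] \<beta>'(2)[of "m + j"] c by simp
  qed simp
  have "d (\<beta>' k) (\<beta>' m) = k - m" if "m \<le> k" for k m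
    using upper[of m "k - m"] d_triangle[of \<one> "\<beta>' m" "\<beta>' k"] d_sym[of "\<beta>' k" "\<beta>' m"] c that
    by simp
  then have "geo 1 \<beta>'" using c by (auto simp: geo_def)
  moreover have "\<beta>' 0 = \<one>" using c[of 0] d_eq_0 by (metis one_closed)
  moreover have "\<exists>p\<in>P. d \<one> p = m + d (\<beta>' m) p" for m
  proof -
    have "infinite (A m (\<beta>' m))" using \<beta>' by (auto simp: Good_def)
    then obtain p where "p \<in> A m (\<beta>' m)" by fastforce
    then show ?thesis by (auto simp: A_def)
  qed
  ultimately show thesis using that by blast
qed


section \<open>Busemann functions\<close>

definition busemann :: "(nat \<Rightarrow> 'a) \<Rightarrow> 'a \<Rightarrow> real" where
  "busemann p = (\<lambda>y\<in>carrier G. lim (\<lambda>n. real (d (p n) y) - real (d (p n) \<one>)))"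

text \<open>Along a geodesic starting at \<open>p 0\<close>, the integers \<open>d (p n) y - d (p n) (p 0)\<close> are
  nonincreasing and bounded below, by the triangle inequality. Hence the limit defining the
  Busemann function is attained at a finite stage.\<close>

lemma busemann_eventually:
  assumes p: "geo L p" and y: "y \<in> carrier G"
  shows "\<forall>\<^sub>F n in sequentially. real (d (p n) y) - real (d (p n) \<one>) = busemann p y"
proof -
  have conv: "\<exists>c. \<forall>\<^sub>F n in sequentially. int (d (p n) z) - int (n * L) = c"
    if z: "z \<in> carrier G" for z
  proof -
    define u where "u n = d (p n) z + d (p 0) z - n * L" for n
    have nn: "n * L \<le> d (p n) z + d (p 0) z" for n
      using d_triangle[of "p n" z "p 0"] d_sym[of z "p 0"] p z geo_carrier[OF p]
      by (auto simp: geo_def)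
    have u: "u n + n * L = d (p n) z + d (p 0) z" for n using nn[of n] by (simp add: u_def)
    have "u n \<le> u m" if "m \<le> n" for m n
    proof -
      have "d (p n) (p m) + m * L = n * L"
        using p that by (auto simp: geo_def algebra_simps diff_mult_distrib)
      then show ?thesis
        using d_triangle[OF geo_carrier[OF p] geo_carrier[OF p] z, of n m] u[of m] u[of n]
        by linarith
    qed
    moreover obtain N where "\<And>n. u N \<le> u n"
      using ex_has_least_nat[of "\<lambda>_. True" 0 u] by auto
    ultimately have "\<forall>n\<ge>N. u n = u N" by (meson le_antisym)
    moreover have "int (d (p n) z) - int (n * L) = int (u n) - int (d (p 0) z)" for n
      using u[of n] by linarith
    ultimately have "\<forall>n\<ge>N. int (d (p n) z) - int (n * L) = int (u N) - int (d (p 0) z)"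
      by metis
    then show ?thesis unfolding eventually_sequentially by blast
  qed
  obtain a where a: "\<forall>\<^sub>F n in sequentially. int (d (p n) y) - int (n * L) = a"
    using conv[OF y] by blast
  obtain b where b: "\<forall>\<^sub>F n in sequentially. int (d (p n) \<one>) - int (n * L) = b"
    using conv[OF one_closed] by blast
  define c where "c = real_of_int (a - b)"
  have ev: "\<forall>\<^sub>F n in sequentially. real (d (p n) y) - real (d (p n) \<one>) = c"
    using a b by eventually_elim (simp add: c_def)
  then have "busemann p y = c"
    unfolding busemann_def using y by (simp add: tendsto_eventually limI)
  then show ?thesis using ev by simp
qed

lemma busemann_eqI:
  assumes "geo L p" "y \<in> carrier G"
    and "\<forall>\<^sub>F n in sequentially. real (d (p n) y) - real (d (p n) \<one>) = c"
  shows "busemann p y = c"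
proof -
  have "\<forall>\<^sub>F n in sequentially. busemann p y = c"
    using busemann_eventually[OF assms(1,2)] assms(3) by eventually_elim simp
  then show ?thesis by simp
qed

lemma busemann_lipschitz:
  assumes "geo L p" "x \<in> carrier G" "y \<in> carrier G"
  shows "busemann p x - busemann p y \<le> real (d x y)"
proof -
  have "\<forall>\<^sub>F n in sequentially. busemann p x - busemann p y \<le> real (d x y)"
    using busemann_eventually[OF assms(1,2)] busemann_eventually[OF assms(1,3)]
  proof eventually_elim
    case (elim n)
    have "d (p n) x \<le> d (p n) y + d x y"
      using d_triangle[of "p n" y x] d_sym assms geo_carrier by fastforce
    then show ?case using elim by linarith
  qed
  then show ?thesis by simp
qed

lemma busemann_one [simp]: "geo L p \<Longrightarrow> busemann p \<one> = 0"
  by (rule busemann_eqI) auto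

lemma busemann_along:
  assumes p: "geo L p"
  shows "busemann p (p n) - busemann p (p m) = (real m - real n) * L"
proof -
  note pc = geo_carrier[OF p]
  have "\<forall>\<^sub>F k in sequentially. busemann p (p n) - busemann p (p m) = (real m - real n) * L"
    using busemann_eventually[OF p pc[of n]] busemann_eventually[OF p pc[of m]]
      eventually_ge_at_top[of n] eventually_ge_at_top[of m]
  proof eventually_elim
    case (elim k)
    then have "d (p k) (p n) = (k - n) * L" "d (p k) (p m) = (k - m) * L"
      using p by (auto simp: geo_def)
    then show ?case using elim by (simp add: of_nat_diff algebra_simps)
  qed
  then show ?thesis by simp
qed

lemma busemann_translate:
  assumes p: "geo L p" and g: "g \<in> carrier G" and y: "y \<in> carrier G"
  shows "busemann (\<lambda>n. inv g \<otimes> p n) y = busemann p (g \<otimes> y) - busemann p g"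
proof (rule busemann_eqI)
  show "geo L (\<lambda>n. inv g \<otimes> p n)" using geo_translate p g by simp
  have gy: "g \<otimes> y \<in> carrier G" using g y by simp
  have shift: "d (inv g \<otimes> p n) z = d (p n) (g \<otimes> z)" if "z \<in> carrier G" for n z
    using d_translate[of g "inv g \<otimes> p n" z] that g geo_carrier[OF p]
    by (simp add: m_assoc[symmetric])
  show "\<forall>\<^sub>F n in sequentially. real (d (inv g \<otimes> p n) y) - real (d (inv g \<otimes> p n) \<one>) =
      busemann p (g \<otimes> y) - busemann p g"
    using busemann_eventually[OF p gy] busemann_eventually[OF p g]
    by eventually_elim (simp add: shift y g)
qed (rule y)

text \<open>The limit of a geodesic is a boundary point because it is unbounded below, whereas the
  function of a vertex \<open>x\<close> is at least \<open>- d x \<one>\<close>.\<close>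

lemma busemann_in_busemann_points:
  assumes p: "geo 1 p"
  shows "busemann p \<in> busemann_points G T"
proof -
  let ?b = "horo_embedding G T"
  have ext: "busemann p \<in> extensional (carrier G)" by (simp add: busemann_def)
  have lip: "busemann p \<in> lip_functions G T"
  proof -
    have "\<bar>busemann p x - busemann p y\<bar> \<le> real (d x y)"
      if "x \<in> carrier G" "y \<in> carrier G" for x y
      using busemann_lipschitz[OF p that] busemann_lipschitz[OF p that(2,1)] d_sym[OF that]
      by linarith
    then show ?thesis using ext busemann_one[OF p] by (simp add: lip_functions_def)
  qed
  have emb: "?b x \<in> lip_functions G T" if x: "x \<in> carrier G" for x
  proof -
    have "\<bar>real (d x y) - real (d x z)\<bar> \<le> real (d y z)"
      if "y \<in> carrier G" "z \<in> carrier G" for y z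
      using d_triangle[OF x that] d_triangle[OF x that(2,1)] d_sym[OF that] by linarith
    then show ?thesis by (simp add: lip_functions_def horo_embedding_def)
  qed
  have lim: "limitin (lip_topology G T) (\<lambda>n. ?b (p n)) (busemann p) sequentially"
  proof -
    have "(\<lambda>n. ?b (p n) y) \<longlonglongrightarrow> busemann p y" if "y \<in> carrier G" for y
      using busemann_eventually[OF p that] that
      by (intro tendsto_eventually) (auto simp: horo_embedding_def)
    moreover have "?b x \<in> topspace (powertop_real (carrier G))" for x
      by (simp add: horo_embedding_def)
    ultimately show ?thesis
      using lip emb[OF geo_carrier[OF p]] ext
      unfolding lip_topology_def limitin_subtopology limitin_componentwise limitin_canonical_iff
      by (intro conjI ballI always_eventually allI)
  qed
  have "busemann p \<in> horo_compactification G T"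
    unfolding horo_compactification_def in_closure_of
  proof (intro conjI allI impI)
    show "busemann p \<in> topspace (lip_topology G T)" using lim by (rule limitin_topspace)
    fix W assume "busemann p \<in> W \<and> openin (lip_topology G T) W"
    then have "\<forall>\<^sub>F n in sequentially. ?b (p n) \<in> W" using lim by (auto simp: limitin_def)
    then obtain n where "?b (p n) \<in> W" by (auto simp: eventually_sequentially)
    then show "\<exists>y. y \<in> ?b ` carrier G \<and> y \<in> W" using geo_carrier[OF p] by blast
  qed
  moreover have "busemann p \<noteq> ?b x" if x: "x \<in> carrier G" for x
  proof
    assume eq: "busemann p = ?b x"
    define n where "n = Suc (d x (p 0))"
    have "real (d x (p n)) - real (d x (p 0)) = - real n"
      using busemann_along[OF p, of n 0] geo_carrier[OF p]
      unfolding eq horo_embedding_def by simp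
    then show False by (simp add: n_def)
  qed
  ultimately have "busemann p \<in> horo_boundary G T" by (auto simp: horo_boundary_def)
  then show ?thesis using lim p geo_1 by (auto simp: busemann_points_def)
qed

lemma busemann_points_subset_boundary: "busemann_points G T \<subseteq> busemann_boundary G T"
proof -
  have "busemann_points G T \<subseteq> horo_compactification G T"
    by (auto simp: busemann_points_def horo_boundary_def)
  moreover have "horo_compactification G T \<subseteq> topspace (lip_topology G T)"
    unfolding horo_compactification_def by (rule closure_of_subset_topspace)
  ultimately show ?thesis
    unfolding busemann_boundary_def by (intro closure_of_subset) (simp add: subset_trans)
qed


section \<open>An element fixing all Busemann functions\<close>

text \<open>The equation says that \<open>y \<mapsto> h (x y) - h x\<close> is again \<open>h\<close>, for every Busemann function
  \<open>h\<close> of a geodesic ray.\<close>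

definition fixes_busemann :: "'a \<Rightarrow> bool" where
  "fixes_busemann x \<longleftrightarrow> (\<forall>p y. geo 1 p \<longrightarrow> y \<in> carrier G \<longrightarrow>
     busemann p (x \<otimes> y) = busemann p x + busemann p y)"

text \<open>The vertices of the ray \<open>\<gamma>\<close> act on the finite set of Busemann functions in finitely many
  ways, so two vertices \<open>\<gamma> m\<close> and \<open>\<gamma> n\<close> act alike and \<open>x = (\<gamma> m)\<^sup>-\<^sup>1 \<gamma> n\<close> acts trivially.
  Moving \<open>\<gamma>\<close> by \<open>(\<gamma> m)\<^sup>-\<^sup>1\<close> gives a ray through the identity and \<open>x\<close>, along which its
  Busemann function falls at unit speed.\<close>

lemma fixing_element:
  assumes fin: "finite (busemann ` {p. geo 1 p})" and \<gamma>: "geo 1 \<gamma>"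
  obtains x L p where "x \<in> carrier G" "0 < L" "d \<one> x = L" "fixes_busemann x"
    "geo 1 p" "busemann p x = - real L"
proof -
  define B where "B = busemann ` {p. geo 1 p}"
  define \<tau> where "\<tau> g h = (\<lambda>y\<in>carrier G. h (g \<otimes> y) - h g)" for g and h :: "'a \<Rightarrow> real"
  note \<gamma>c = geo_carrier[OF \<gamma>]
  have \<tau>_busemann: "\<tau> g (busemann p) = busemann (\<lambda>n. inv g \<otimes> p n)"
    if "g \<in> carrier G" "geo 1 p" for g p
    using busemann_translate[OF that(2,1)] by (auto simp: \<tau>_def busemann_def[of "\<lambda>n. inv g \<otimes> p n"])
  have \<tau>_B: "\<tau> g h \<in> B" if "g \<in> carrier G" "h \<in> B" for g h
    using that \<tau>_busemann geo_translate[OF inv_closed] unfolding B_def by fastforce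
  have "(\<lambda>n. restrict (\<tau> (\<gamma> n)) B) ` UNIV \<subseteq> B \<rightarrow>\<^sub>E B"
    using \<tau>_B[OF \<gamma>c] by auto
  moreover have "finite (B \<rightarrow>\<^sub>E B)" using fin by (simp add: B_def finite_PiE)
  ultimately have "\<not> inj (\<lambda>n. restrict (\<tau> (\<gamma> n)) B)"
    using finite_imageD finite_subset infinite_UNIV_nat by blast
  then obtain m n where mn: "m < n" "restrict (\<tau> (\<gamma> m)) B = restrict (\<tau> (\<gamma> n)) B"
    unfolding inj_def by (metis linorder_neqE_nat)
  define x where "x = inv (\<gamma> m) \<otimes> \<gamma> n"
  have xc: "x \<in> carrier G" using \<gamma>c by (simp add: x_def)
  have "fixes_busemann x"
    unfolding fixes_busemann_def
  proof (intro allI impI)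
    fix p y assume p: "geo 1 p" and y: "y \<in> carrier G"
    \<comment> \<open>The action is a right action, so \<open>\<tau> x = \<tau> (\<gamma> n) \<circ> \<tau> (inv (\<gamma> m))\<close>; replacing
      \<open>\<tau> (\<gamma> n)\<close> by \<open>\<tau> (\<gamma> m)\<close> leaves the identity.\<close>
    define h where "h = \<tau> (inv (\<gamma> m)) (busemann p)"
    have "h \<in> B" unfolding h_def by (rule \<tau>_B) (use \<gamma>c p in \<open>auto simp: B_def\<close>)
    then have "\<tau> (\<gamma> m) h y = \<tau> (\<gamma> n) h y" using mn(2) by (metis restrict_apply')
    then show "busemann p (x \<otimes> y) = busemann p x + busemann p y"
      using \<gamma>c y busemann_one[OF p] by (simp add: \<tau>_def h_def x_def m_assoc[symmetric])
  qed
  moreover have "d \<one> x = n - m"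
  proof -
    have "d \<one> x = d (\<gamma> m) (\<gamma> n)"
      using d_translate[of "inv (\<gamma> m)" "\<gamma> m" "\<gamma> n"] \<gamma>c by (simp add: x_def)
    also have "\<dots> = n - m" using \<gamma> mn(1) d_sym \<gamma>c by (simp add: geo_def)
    finally show ?thesis .
  qed
  moreover have "busemann (\<lambda>k. inv (\<gamma> m) \<otimes> \<gamma> k) x = - real (n - m)"
    using busemann_translate[OF \<gamma> \<gamma>c[of m] xc] busemann_along[OF \<gamma>, of n m] mn(1) \<gamma>c
    by (simp add: x_def m_assoc[symmetric] of_nat_diff)
  moreover have "geo 1 (\<lambda>k. inv (\<gamma> m) \<otimes> \<gamma> k)" using geo_translate[OF _ \<gamma>] \<gamma>c by simp
  ultimately show thesis
    using that[of x "n - m"] xc mn(1) by simp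
qed

text \<open>The length of \<open>x\<^sup>n\<close> is at most \<open>n L\<close> by the triangle inequality. It is at least that
  because the Busemann function of \<open>p\<close>, which is 1-Lipschitz, is additive on the powers of the
  element \<open>x\<close> that fixes it.\<close>

lemma powers_geo:
  assumes x: "x \<in> carrier G" "d \<one> x = L" "fixes_busemann x"
    and p: "geo 1 p" "busemann p x = - real L"
  shows "geo L (\<lambda>n. x [^] n)"
proof -
  have upper: "d \<one> (x [^] n) \<le> n * L" for n :: nat
  proof (induction n)
    case (Suc n)
    have "d (x [^] n) (x [^] n \<otimes> x) = L" using d_translate[of "x [^] n" \<one> x] x by simp
    then show ?case using Suc d_triangle[of \<one> "x [^] n" "x [^] n \<otimes> x"] x by simp
  qed simp
  have val: "busemann p (x [^] n) = - (real n * L)" for n :: nat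
  proof (induction n)
    case (Suc n)
    have "x [^] Suc n = x \<otimes> x [^] n" by (rule nat_pow_Suc2[OF x(1)])
    moreover have "busemann p (x \<otimes> x [^] n) = busemann p x + busemann p (x [^] n)"
      using x p unfolding fixes_busemann_def by simp
    ultimately show ?case using Suc p by (simp add: algebra_simps del: nat_pow_Suc)
  qed (use p in simp)
  have norm: "d \<one> (x [^] n) = n * L" for n :: nat
  proof -
    have "real (n * L) \<le> real (d \<one> (x [^] n))"
      using busemann_lipschitz[OF p(1) one_closed nat_pow_closed[OF x(1)], of n] val[of n] p by simp
    then show ?thesis using upper[of n] by linarith
  qed
  have "d (x [^] k) (x [^] m) = (k - m) * L" if "m \<le> k" for k m :: nat
  proof -
    have "x [^] k = x [^] m \<otimes> x [^] (k - m)" using that x by (simp add: nat_pow_mult)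
    then have "d (x [^] m) (x [^] k) = d \<one> (x [^] (k - m))"
      using d_translate[of "x [^] m" \<one> "x [^] (k - m)"] x by simp
    then show ?thesis using norm d_sym x by simp
  qed
  then show ?thesis using x by (auto simp: geo_def)
qed


section \<open>The subgroup generated by a geodesic element\<close>

lemma busemann_powers_shift:
  assumes x: "x \<in> carrier G" and p: "geo L (\<lambda>n. x [^] (n::nat))" and y: "y \<in> carrier G"
  shows "busemann (\<lambda>n. x [^] (n::nat)) (x \<otimes> y) = busemann (\<lambda>n. x [^] (n::nat)) y - L"
proof (rule busemann_eqI[OF p])
  let ?f = "busemann (\<lambda>n. x [^] (n::nat))"
  have norm: "d (x [^] n) \<one> = n * L" for n :: nat
    using p unfolding geo_def by (metis diff_zero le0 nat_pow_0)
  have "\<forall>\<^sub>F n in sequentially. real (d (x [^] Suc n) (x \<otimes> y)) - real (d (x [^] Suc n) \<one>) = ?f y - L"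
    using busemann_eventually[OF p y]
  proof eventually_elim
    case (elim n)
    have "d (x [^] Suc n) (x \<otimes> y) = d (x [^] n) y"
      unfolding nat_pow_Suc2[OF x] using d_translate x y by simp
    then show ?case using elim norm[of n] norm[of "Suc n"] by (simp add: algebra_simps)
  qed
  then show "\<forall>\<^sub>F n in sequentially. real (d (x [^] n) (x \<otimes> y)) - real (d (x [^] n) \<one>) = ?f y - L"
    by (rule eventually_sequentially_Suc[THEN iffD1])
qed (use x y in simp)

lemma busemann_powers_shift_int:
  assumes x: "x \<in> carrier G" and p: "geo L (\<lambda>n. x [^] (n::nat))" and y: "y \<in> carrier G"
  shows "busemann (\<lambda>n. x [^] (n::nat)) (x [^] (k::int) \<otimes> y) =
    busemann (\<lambda>n. x [^] (n::nat)) y - k * L"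
proof -
  let ?f = "busemann (\<lambda>n. x [^] (n::nat))"
  have nat: "?f (x [^] n \<otimes> z) = ?f z - real n * L" if z: "z \<in> carrier G" for n :: nat and z
  proof (induction n)
    case (Suc n)
    then show ?case
      unfolding nat_pow_Suc2[OF x] using busemann_powers_shift[OF x p, of "x [^] n \<otimes> z"] x z
      by (simp add: m_assoc algebra_simps)
  qed (use z in simp)
  show ?thesis
  proof (cases k rule: int_cases2)
    case (nonneg n)
    then show ?thesis using nat[OF y, of n] by (simp add: int_pow_int)
  next
    case (nonpos n)
    have "x [^] n \<otimes> (inv (x [^] n) \<otimes> y) = y" using x y by (simp add: m_assoc[symmetric])
    then show ?thesis
      using nat[of "inv (x [^] n) \<otimes> y" n] x y nonpos by (simp add: int_pow_neg_int)
  qed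
qed

text \<open>The group is a union of translates of the strip below by powers of \<open>x\<close>, so its finiteness
  makes the powers of \<open>x\<close> a subgroup of finite index. The argument by contradiction is the
  one outlined at the start.\<close>

lemma finite_strip:
  assumes x: "x \<in> carrier G" "fixes_busemann x"
    and p: "geo L (\<lambda>n. x [^] (n::nat))" and L: "0 < L"
  defines "f \<equiv> busemann (\<lambda>n. x [^] (n::nat))"
  shows "finite {a \<in> carrier G. 0 \<le> f a \<and> f a < L}"
proof (rule ccontr)
  assume inf: "infinite {a \<in> carrier G. 0 \<le> f a \<and> f a < L}"
  note shift = busemann_powers_shift_int[OF x(1) p, folded f_def]
  note lip = busemann_lipschitz[OF p, folded f_def]
  have norm: "d (x [^] n) \<one> = n * L" for n :: nat
    using p unfolding geo_def by (metis diff_zero le0 nat_pow_0)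
  have f_pow: "f (x [^] n) = - (real n * L)" for n :: nat
    using shift[of \<one> "int n"] x busemann_one[OF p] by (simp add: f_def int_pow_int)
  define N where "N a = (LEAST n. real (d (x [^] n) a) = n * L + f a)" for a
  have N: "real (d (x [^] N a) a) = N a * L + f a" if "a \<in> carrier G" for a
  proof -
    have "\<forall>\<^sub>F n in sequentially. real (d (x [^] n) a) = n * L + f a"
      using busemann_eventually[OF p that] by eventually_elim (simp add: norm f_def)
    then have "\<exists>n. real (d (x [^] n) a) = n * L + f a" by (auto simp: eventually_sequentially)
    then show ?thesis unfolding N_def by (rule LeastI_ex)
  qed
  \<comment> \<open>The stage before \<open>N a\<close> is needed at the end. Elements with \<open>N a = 0\<close> have length
    \<open>f a < L\<close>, so leaving them out costs only finitely many.\<close>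
  define M where "M = {a \<in> carrier G. 0 \<le> f a \<and> f a < L \<and> N a \<noteq> 0}"
  have "{a \<in> carrier G. 0 \<le> f a \<and> f a < L} \<subseteq> M \<union> {a \<in> carrier G. d \<one> a \<le> L}"
    using N by (fastforce simp: M_def)
  then have M_inf: "infinite M" using inf finite_ball[of \<one> L] by (meson finite_UnI finite_subset one_closed)
  define q where "q a = x [^] (- int (N a)) \<otimes> a" for a
  have q_carrier: "q a \<in> carrier G" if "a \<in> M" for a using that x by (auto simp: q_def M_def)
  have f_q: "f (q a) = N a * L + f a" if "a \<in> M" for a
    using shift[of a "- int (N a)"] that by (simp add: q_def M_def)
  have d_q: "d (x [^] i \<otimes> \<one>) (q a) = d (x [^] (int (N a) + i)) a" if "a \<in> M" for a i
  proof -
    have "x [^] int (N a) \<otimes> (x [^] i \<otimes> \<one>) = x [^] (int (N a) + i)"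
      using x by (simp add: int_pow_mult)
    moreover have "x [^] int (N a) \<otimes> q a = a"
      using x that by (simp add: q_def M_def m_assoc[symmetric] int_pow_mult[symmetric])
    ultimately show ?thesis
      using d_translate[of "x [^] int (N a)" "x [^] i \<otimes> \<one>" "q a"] q_carrier[OF that] x by simp
  qed
  have norm_q: "real (d \<one> (q a)) = N a * L + f a" if "a \<in> M" for a
    using d_q[OF that, of 0] N[of a] that by (simp add: M_def int_pow_int)
  \<comment> \<open>As \<open>f a\<close> lies in an interval of length \<open>L\<close>, the value \<open>f (q a)\<close> determines \<open>N a\<close>.\<close>
  have "inj_on q M"
  proof (rule inj_onI)
    fix a b assume ab: "a \<in> M" "b \<in> M" "q a = q b"
    have "real (N a) * L + f a = real (N b) * L + f b"
      using f_q[OF ab(1)] f_q[OF ab(2)] ab(3) by simp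
    then have "real (N a) * L < (real (N b) + 1) * L" "real (N b) * L < (real (N a) + 1) * L"
      using ab by (auto simp: M_def algebra_simps)
    then have "real (N a) < real (N b) + 1" "real (N b) < real (N a) + 1"
      using L by (auto simp: mult_less_cancel_right)
    then have "N a = N b" by linarith
    then show "a = b" using ab x by (auto simp: q_def M_def)
  qed
  then have "infinite (q ` M)" using M_inf finite_imageD by blast
  moreover have "q ` M \<subseteq> carrier G" using q_carrier by auto
  ultimately obtain \<beta> where \<beta>: "geo 1 \<beta>" "\<beta> 0 = \<one>" "\<And>m. \<exists>r\<in>q ` M. d \<one> r = m + d (\<beta> m) r"
    using geodesic_towards by metis
  note \<beta>c = geo_carrier[OF \<beta>(1)]
  have f_\<beta>: "real m \<le> f (\<beta> m)" for m
  proof -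
    obtain a where a: "a \<in> M" "d \<one> (q a) = m + d (\<beta> m) (q a)" using \<beta>(3)[of m] by blast
    have "f (q a) - f (\<beta> m) \<le> real (d (\<beta> m) (q a))"
      using lip[OF q_carrier[OF a(1)] \<beta>c] d_sym[OF q_carrier[OF a(1)] \<beta>c] by simp
    then show ?thesis using a f_q norm_q by fastforce
  qed
  define h where "h = busemann \<beta>"
  have d_\<beta>_one: "d (\<beta> m) \<one> = m" for m
    using \<beta>(1,2) unfolding geo_def by (metis diff_zero le0 mult.right_neutral)
  have "real L \<le> h x"
  proof -
    have "\<forall>\<^sub>F m in sequentially. real L \<le> h x"
      using busemann_eventually[OF \<beta>(1) x(1)]
    proof eventually_elim
      case (elim m)
      have "f x = - real L" using f_pow[of 1] x by simp
      then show ?case using elim f_\<beta>[of m] lip[OF \<beta>c x(1), of m] d_\<beta>_one[of m] by (simp add: h_def)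
    qed
    then show ?thesis by simp
  qed
  moreover have "h (x \<otimes> inv x) = h x + h (inv x)"
    using x(1) \<beta>(1) x(2) unfolding fixes_busemann_def h_def by blast
  ultimately have "h (inv x) \<le> - real L" using x busemann_one[OF \<beta>(1)] by (simp add: h_def)
  moreover obtain m where "real (d (\<beta> m) (inv x)) - real (d (\<beta> m) \<one>) = h (inv x)"
    using busemann_eventually[OF \<beta>(1) inv_closed[OF x(1)]]
    by (auto simp: eventually_sequentially h_def)
  ultimately have m: "real (d (\<beta> m) (inv x)) \<le> real m - L" using d_\<beta>_one by simp
  \<comment> \<open>A shortest path from the identity to \<open>q a\<close> can be led through \<open>inv x\<close> and then
    \<open>\<beta> m\<close>; moving it by the power \<open>N a\<close> of \<open>x\<close> contradicts the choice of \<open>N a\<close>.\<close>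
  obtain a where a: "a \<in> M" "d \<one> (q a) = m + d (\<beta> m) (q a)" using \<beta>(3)[of m] by blast
  obtain k where k: "N a = Suc k" using a(1) by (cases "N a") (auto simp: M_def)
  have ac: "a \<in> carrier G" using a by (simp add: M_def)
  have "d (x [^] k) a = d (inv x) (q a)"
    using d_q[OF a(1), of "-1"] x k by (simp add: int_pow_neg int_pow_int)
  also have "\<dots> \<le> d (inv x) (\<beta> m) + d (\<beta> m) (q a)"
    using d_triangle x q_carrier[OF a(1)] \<beta>c by simp
  finally have "real (d (x [^] k) a) \<le> real (d (\<beta> m) (inv x)) + real (d (\<beta> m) (q a))"
    using d_sym[OF inv_closed[OF x(1)] \<beta>c[of m]] by simp
  also have "\<dots> \<le> real (d \<one> (q a)) - L" using m a(2) by simp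
  also have "\<dots> = k * L + f a" using norm_q[OF a(1)] k by (simp add: algebra_simps)
  finally have "real (d (x [^] k) a) \<le> k * L + f a" .
  moreover have "k * L + f a \<le> real (d (x [^] k) a)"
    using lip[OF ac nat_pow_closed[OF x(1)], of k] f_pow[of k]
      d_sym[OF ac nat_pow_closed[OF x(1)], of k] by simp
  ultimately have "N a \<le> k" unfolding N_def by (intro Least_le) simp
  then show False using k by simp
qed

theorem virtually_Z_if_finite_busemann:
  assumes inf: "infinite (carrier G)" and fin: "finite (busemann ` {p. geo 1 p})"
  shows "virtually_Z G"
proof -
  obtain \<gamma> where "geo 1 \<gamma>" using geodesic_towards[OF subset_refl inf] by blast
  then obtain x L p where x: "x \<in> carrier G" "0 < L" "d \<one> x = L" "fixes_busemann x"
    and p: "geo 1 p" "busemann p x = - real L"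
    using fixing_element[OF fin] by metis
  have geo: "geo L (\<lambda>n. x [^] (n::nat))" using powers_geo x p by blast
  define f where "f = busemann (\<lambda>n. x [^] (n::nat))"
  define M where "M = {a \<in> carrier G. 0 \<le> f a \<and> f a < L}"
  note shift = busemann_powers_shift_int[OF x(1) geo, folded f_def]
  have "finite M" using finite_strip[OF x(1,4) geo x(2)] by (simp add: M_def f_def)
  define H where "H = generate G {x}"
  have H: "H = range (\<lambda>k::int. x [^] k)" using generate_pow[OF x(1)] by (auto simp: H_def)
  have sub: "subgroup H G" unfolding H_def using x(1) by (intro generate_is_subgroup) simp
  have "inj (\<lambda>k::int. x [^] k)"
  proof (rule injI)
    fix i j :: int assume "x [^] i = x [^] j"
    then have "f \<one> - i * L = f \<one> - j * L"
      using shift[OF one_closed, of i] shift[OF one_closed, of j] by metis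
    then show "i = j" using x(2) by simp
  qed
  then have "infinite H" unfolding H using finite_imageD infinite_UNIV_int by blast
  moreover have "rcosets H \<subseteq> (\<lambda>a. H #> a) ` M"
  proof
    fix C assume "C \<in> rcosets H"
    then obtain g where g: "g \<in> carrier G" "C = H #> g" by (auto simp: RCOSETS_def)
    \<comment> \<open>Multiplying by \<open>x\<close> lowers \<open>f\<close> by \<open>L\<close>, so this power moves \<open>g\<close> into the strip.\<close>
    define k where "k = \<lfloor>f g / L\<rfloor>"
    have "of_int k * real L \<le> f g" "f g < (of_int k + 1) * real L"
      using x(2) floor_divide_lower[of "real L" "f g"] floor_divide_upper[of "real L" "f g"]
      by (auto simp: k_def)
    then have "x [^] k \<otimes> g \<in> M" using shift[OF g(1), of k] g x by (simp add: M_def algebra_simps)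
    moreover have "H #> (x [^] k \<otimes> g) = H #> g"
    proof -
      have "x [^] k \<in> H" by (auto simp: H)
      then have "H #> (x [^] k) = H"
        using coset_join2 sub subgroup.subset[OF sub] by blast
      then show ?thesis
        using coset_mult_assoc[OF subgroup.subset[OF sub], of "x [^] k" g] x g by simp
    qed
    ultimately show "C \<in> (\<lambda>a. H #> a) ` M" using g by (metis imageI)
  qed
  then have "finite (rcosets H)" using \<open>finite M\<close> finite_surj by blast
  moreover have "cyclic_group (G\<lparr>carrier := H\<rparr>)"
    using cyclic_group_generated[of x] x(1) by (simp add: subgroup_generated_def H_def)
  ultimately show ?thesis using sub unfolding virtually_Z_def by blast
qed

end

theorem lemma3p1:
  fixes G :: "('a, 'b) monoid_scheme" (structure) and S :: "'a set"
  assumes "group G"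
    and "infinite (carrier G)"
    and "S \<subseteq> carrier G"
    and "finite S"
    and "set_inv S = S"
    and "generate G S = carrier G"
    and "\<forall>x \<in> carrier G. finite (busemann_boundary G (S \<union> {x, inv x}))"
  shows "virtually_Z G"
proof -
  interpret group G by fact
  define T where "T = S \<union> {\<one>, inv \<one>}"
  have inv_S: "inv s \<in> S" if "s \<in> S" for s
    using assms(5) that unfolding SET_INV_def by blast
  interpret word_metric G T
  proof
    show "T \<subseteq> carrier G" "finite T" using assms(3,4) by (auto simp: T_def)
    show "inv s \<in> T" if "s \<in> T" for s using that inv_S by (auto simp: T_def)
    have "generate G S \<subseteq> generate G T" by (rule mono_generate) (auto simp: T_def)
    then show "generate G T = carrier G"
      using assms(6) generate_incl[OF \<open>T \<subseteq> carrier G\<close>] by blast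
  qed
  have "finite (busemann_boundary G T)" using assms(7) unfolding T_def by blast
  moreover have "busemann ` {p. geo 1 p} \<subseteq> busemann_boundary G T"
    using busemann_in_busemann_points busemann_points_subset_boundary by blast
  ultimately have "finite (busemann ` {p. geo 1 p})" by (rule rev_finite_subset)
  then show ?thesis using virtually_Z_if_finite_busemann assms(2) by blast
qed

end
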